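(* Let $n \geq 1$ and let $G$ be the hypertree $HT(n)$. Then the total domination number of $G$ is $$\gamma_t(G) = \begin{cases} \frac{1}{7}(2^{n+2}+3) & \text{if } n\equiv 0 \pmod 3,\\ \frac{1}{7}(2^{n+2}-1)+1 & \text{if } n\equiv 1 \pmod 3,\\ \frac{2}{7}(2^{n+1}-1) & \text{if } n\equiv 2 \pmod 3.\end{cases}$$
   Context: The hypertree $HT(n)$ has vertex set $\{1,2,\dots,2^{n+1}-1\}$. Its edges are the edges of the complete binary tree of height $n$ in which vertex $x$ has children $2x$ and $2x+1$ (the root is $1$, at level $0$; vertex $v$ lies at level $i$ iff $2^i \le v \le 2^{i+1}-1$), together with horizontal edges: for each level $i\ge 1$, two vertices at level $i$ are adjacent if their labels differ by $2^{i-1}$. A set $S\subseteq V(G)$ is a total dominating set if every vertex of $V(G)$ is adjacent to some vertex of $S$; $\gamma_t(G)$ is the minimum cardinality of a total dominating set. *)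

theory Defs
  imports Complex_Main
begin

text \<open>Simple undirected graphs: a vertex set together with a set of two-element edge sets.\<close>

type_synonym 'a ugraph = "'a set \<times> 'a set set"

definition verts :: "'a ugraph \<Rightarrow> 'a set" where
  "verts G = fst G"

definition edges :: "'a ugraph \<Rightarrow> 'a set set" where
  "edges G = snd G"

definition adjacent :: "'a ugraph \<Rightarrow> 'a \<Rightarrow> 'a \<Rightarrow> bool" where
  "adjacent G u v \<longleftrightarrow> {u, v} \<in> edges G"

definition total_dominating_set :: "'a ugraph \<Rightarrow> 'a set \<Rightarrow> bool" where
  "total_dominating_set G S \<longleftrightarrow> S \<subseteq> verts G \<and> (\<forall>v\<in>verts G. \<exists>u\<in>S. adjacent G v u)"

text \<open>Meaningful for finite graphs without isolated vertices; otherwise the minimum may be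
  taken over the empty set.\<close>

definition total_domination_number :: "'a ugraph \<Rightarrow> nat" where
  "total_domination_number G = Min {card S | S. total_dominating_set G S}"

definition level :: "nat \<Rightarrow> nat set" where
  "level i = {2 ^ i .. 2 ^ (i + 1) - 1}"

definition hypertree_verts :: "nat \<Rightarrow> nat set" where
  "hypertree_verts n = {1 .. 2 ^ (n + 1) - 1}"

definition tree_edges :: "nat \<Rightarrow> nat set set" where
  "tree_edges n = {{x, y} | x y. x \<in> hypertree_verts n \<and> y \<in> hypertree_verts n \<and>
                                 (y = 2 * x \<or> y = 2 * x + 1)}"

definition horizontal_edges :: "nat \<Rightarrow> nat set set" where
  "horizontal_edges n = {{u, v} | u v i. 1 \<le> i \<and> i \<le> n \<and> u \<in> level i \<and> v \<in> level i \<and>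
                                       v = u + 2 ^ (i - 1)}"

definition HT :: "nat \<Rightarrow> nat ugraph" where
  "HT n = (hypertree_verts n, tree_edges n \<union> horizontal_edges n)"

end

theory Submission
  imports Defs
begin

text \<open>
  For \<open>m \<ge> 1\<close> the vertices \<open>2 x\<close>, with \<open>x\<close> ranging over level \<open>m - 1\<close>, have pairwise disjoint open
  neighbourhoods, all lying in the levels \<open>m - 1\<close>, \<open>m\<close>, \<open>m + 1\<close>. Hence a total dominating set has
  at least \<open>2 ^ (m - 1)\<close> elements in these three levels. Applying this to \<open>m = n, n - 3, n - 6, \<dots>\<close>
  gives the lower bound, except near the root: for \<open>n mod 3 = 0\<close> one more element is needed to
  dominate the root, and for \<open>n mod 3 = 1\<close> the three lowest levels need two elements, one dominating
  the root and one dominating that element. Conversely, for \<open>i \<ge> 1\<close> the whole level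
  \<open>i\<close> dominates the levels \<open>i - 1\<close>, \<open>i\<close>, \<open>i + 1\<close>, so the union of the levels
  \<open>n - 1, n - 4, n - 7, \<dots>\<close>, corrected near the root, attains the bound.
\<close>

text \<open>Adjacency in the union of all \<open>HT n\<close>, so that inductions on \<open>n\<close> stay within one graph.
  Junk case: \<open>0\<close>, which is not a vertex, is adjacent to \<open>1\<close> because \<open>1 div 2 = 0\<close>.\<close>

definition hypertree_adj :: "nat \<Rightarrow> nat \<Rightarrow> bool" where
  "hypertree_adj u v \<longleftrightarrow> v = u div 2 \<or> u = v div 2 \<or>
     (\<exists>i\<ge>1. u \<in> level i \<and> v \<in> level i \<and> (v = u + 2 ^ (i - 1) \<or> u = v + 2 ^ (i - 1)))"

section \<open>Levels, vertices and adjacency\<close>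

lemma mem_level_iff: "v \<in> level i \<longleftrightarrow> 2 ^ i \<le> v \<and> v < 2 ^ (i + 1)"
  using zero_less_power[of "2::nat" "i + 1"] unfolding level_def atLeastAtMost_iff by linarith

lemma mem_hypertree_verts_iff: "v \<in> hypertree_verts n \<longleftrightarrow> 1 \<le> v \<and> v < 2 ^ (n + 1)"
  using zero_less_power[of "2::nat" "n + 1"] unfolding hypertree_verts_def atLeastAtMost_iff
  by linarith

lemma level_unique:
  assumes "v \<in> level i" "v \<in> level j"
  shows "i = j"
proof -
  have "i < j + 1" "j < i + 1"
    using assms power_less_imp_less_exp[of "2::nat"] unfolding mem_level_iff
    by (meson one_less_numeral_iff order.strict_trans1 semiring_norm(76))+
  then show ?thesis by simp
qed

lemma level_subset_hypertree_verts:
  assumes "i \<le> n"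
  shows "level i \<subseteq> hypertree_verts n"
proof
  fix v assume "v \<in> level i"
  then have v: "2 ^ i \<le> v" "v < 2 ^ (i + 1)" by (auto simp: mem_level_iff)
  have "(1::nat) \<le> 2 ^ i" by simp
  moreover have "(2::nat) ^ (i + 1) \<le> 2 ^ (n + 1)" using assms by (intro power_increasing) auto
  ultimately show "v \<in> hypertree_verts n" using v unfolding mem_hypertree_verts_iff by linarith
qed

lemma adjacent_HT_iff:
  assumes "u \<in> hypertree_verts n" "v \<in> hypertree_verts n"
  shows "adjacent (HT n) u v \<longleftrightarrow> hypertree_adj u v"
proof
  assume "adjacent (HT n) u v"
  then show "hypertree_adj u v"
    by (auto simp: adjacent_def HT_def edges_def tree_edges_def horizontal_edges_def
        hypertree_adj_def doubleton_eq_iff)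
next
  assume "hypertree_adj u v"
  then consider (tree) "v = u div 2 \<or> u = v div 2"
    | (hor) i where "i \<ge> 1" "u \<in> level i" "v \<in> level i"
        "v = u + 2 ^ (i - 1) \<or> u = v + 2 ^ (i - 1)"
    unfolding hypertree_adj_def by blast
  then show "adjacent (HT n) u v"
  proof cases
    case tree
    moreover have "a = 2 * (a div 2) \<or> a = 2 * (a div 2) + 1" for a :: nat by linarith
    ultimately have "(v = 2 * u \<or> v = 2 * u + 1) \<or> (u = 2 * v \<or> u = 2 * v + 1)" by metis
    then have "{u, v} \<in> tree_edges n"
      using assms unfolding tree_edges_def by blast
    then show ?thesis by (simp add: adjacent_def HT_def edges_def)
  next
    case hor
    have "2 ^ i < (2::nat) ^ (n + 1)"
      using hor(2) assms(1) by (auto simp: mem_level_iff mem_hypertree_verts_iff)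
    then have "i < n + 1" by (rule power_less_imp_less_exp[rotated]) simp
    then have "i \<le> n" by simp
    then have "{u, v} \<in> horizontal_edges n"
      using hor unfolding horizontal_edges_def by blast
    then show ?thesis by (simp add: adjacent_def HT_def edges_def)
  qed
qed

lemma hypertree_adj_level_Suc_iff:
  assumes "u \<in> level (Suc m)"
  shows "hypertree_adj u v \<longleftrightarrow> v = u div 2 \<or> u = v div 2 \<or>
    (v \<in> level (Suc m) \<and> (v = u + 2 ^ m \<or> u = v + 2 ^ m))"
  unfolding hypertree_adj_def using assms level_unique[OF assms]
  by (metis One_nat_def Suc_le_mono diff_Suc_1 le0)

section \<open>Lower bound from disjoint neighbourhoods\<close>

lemma card_inter_three_levels_ge:
  assumes dom: "\<forall>v\<in>level (Suc m). \<exists>u\<in>S. hypertree_adj v u"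
  shows "2 ^ m \<le> card (S \<inter> {2 ^ m..<2 ^ (m + 3)})"
proof -
  have dbl: "2 * x \<in> level (Suc m)" if "x \<in> level m" for x
    using that by (simp add: mem_level_iff)
  with dom have "\<forall>x\<in>level m. \<exists>u\<in>S. hypertree_adj (2 * x) u" by blast
  then obtain f where f: "\<And>x. x \<in> level m \<Longrightarrow> f x \<in> S \<and> hypertree_adj (2 * x) (f x)"
    by metis
  have nbr: "f x = x \<or> (4 * x \<le> f x \<and> f x < 4 * x + 2) \<or>
      (2 * 2 ^ m \<le> f x \<and> f x < 4 * 2 ^ m \<and> (f x = 2 * x + 2 ^ m \<or> 2 * x = f x + 2 ^ m))"
    if "x \<in> level m" for x
    using f[OF that] unfolding hypertree_adj_level_Suc_iff[OF dbl[OF that]]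
    by (auto simp: mem_level_iff)
  \<comment> \<open>The parent and the children of \<open>2 * x\<close> lie in different levels and
    determine \<open>x\<close>. A horizontal neighbour shared by \<open>2 * x\<close> and
    \<open>2 * y\<close> with \<open>x \<noteq> y\<close> would force \<open>x\<close> and
    \<open>y\<close> to differ by \<open>2 ^ m\<close>, too far apart for level
    \<open>m\<close>.\<close>
  have "inj_on f (level m)"
  proof (rule inj_onI)
    fix x y assume xy: "x \<in> level m" "y \<in> level m" "f x = f y"
    have "2 ^ m \<le> x" "x < 2 * 2 ^ m" "2 ^ m \<le> y" "y < 2 * 2 ^ m"
      using xy by (auto simp: mem_level_iff)
    with nbr[OF xy(1)] nbr[OF xy(2)] xy(3) show "x = y"
      by (elim disjE conjE) linarith+
  qed
  moreover have "f ` level m \<subseteq> S \<inter> {2 ^ m..<2 ^ (m + 3)}"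
  proof (rule image_subsetI)
    fix x assume x: "x \<in> level m"
    have "2 ^ m \<le> x" "x < 2 * 2 ^ m"
      using x by (auto simp: mem_level_iff)
    with nbr[OF x] have "2 ^ m \<le> f x" "f x < 8 * 2 ^ m"
      by linarith+
    with f[OF x] show "f x \<in> S \<inter> {2 ^ m..<2 ^ (m + 3)}"
      by (simp add: power_add)
  qed
  ultimately have "card (level m) \<le> card (S \<inter> {2 ^ m..<2 ^ (m + 3)})"
    by (meson card_inj_on_le finite_Int finite_atLeastLessThan)
  then show ?thesis by (simp add: level_def)
qed

text \<open>Each recursion step accounts for a block of three levels. The value at \<open>0\<close>
  is no domination number, as a single vertex has no neighbour; it counts the element of level 1
  that dominates the root.\<close>

fun gamma_HT :: "nat \<Rightarrow> nat" where
  "gamma_HT 0 = 1"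
| "gamma_HT (Suc 0) = 2"
| "gamma_HT (Suc (Suc 0)) = 2"
| "gamma_HT (Suc (Suc (Suc n))) = 2 ^ (n + 2) + gamma_HT n"

text \<open>In each residue class the recursion telescopes by
  \<open>2 ^ (n + 5) - 2 ^ (n + 2) = 7 * 2 ^ (n + 2)\<close>.\<close>

lemma gamma_HT_closed_form:
  "real (gamma_HT n) =
    (if n mod 3 = 0 then 1 / 7 * (2 ^ (n + 2) + 3)
     else if n mod 3 = 1 then 1 / 7 * (2 ^ (n + 2) - 1) + 1
     else 2 / 7 * (2 ^ (n + 1) - 1))"
proof (induction n rule: gamma_HT.induct)
  case (4 n)
  have "Suc (Suc (Suc n)) mod 3 = n mod 3" by presburger
  with 4 show ?case by (simp split: if_splits)
qed auto

text \<open>The root lies only in level 0, so it has no horizontal edge, and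
  \<open>u \<noteq> 0\<close> excludes its junk parent.\<close>

lemma hypertree_adj_root:
  assumes "hypertree_adj 1 u" "u \<noteq> 0"
  shows "u \<in> level 1"
proof -
  have "i = 0" if "1 \<in> level i" for i
    using that level_unique[of 1 i 0] by (simp add: mem_level_iff)
  with assms have "u div 2 = 1" unfolding hypertree_adj_def by fastforce
  then have "2 \<le> u" "u < 4" by linarith+
  then show ?thesis by (simp add: mem_level_iff)
qed

text \<open>The count includes level \<open>n + 1\<close>, one beyond \<open>HT n\<close>: inside a
  taller tree, level \<open>n\<close> may be dominated from there. This lets the induction split off
  the block centred at the top level.\<close>

lemma gamma_HT_le_card:
  assumes "0 \<notin> S" and "\<forall>v\<in>hypertree_verts n. \<exists>u\<in>S. hypertree_adj v u"
  shows "gamma_HT n \<le> card (S \<inter> {1..<2 ^ (n + 2)})"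
  using assms(2)
proof (induction n rule: gamma_HT.induct)
  case 1
  have "1 \<in> hypertree_verts 0" by (simp add: mem_hypertree_verts_iff)
  with 1 obtain u where "u \<in> S" "hypertree_adj 1 u" by blast
  then have "u \<in> S \<inter> {1..<2 ^ (0 + 2)}"
    using hypertree_adj_root[of u] assms(1) by (force simp: mem_level_iff)
  then have "0 < card (S \<inter> {1..<2 ^ (0 + 2)})" by (subst card_gt_0_iff) auto
  then show ?case by simp
next
  case 2
  have "1 \<in> hypertree_verts (Suc 0)" by (simp add: mem_hypertree_verts_iff)
  with 2 obtain a where a: "a \<in> S" "hypertree_adj 1 a" by blast
  then have a1: "a \<in> level 1" using hypertree_adj_root assms(1) by metis
  then have a23: "2 \<le> a" "a < 4" by (auto simp: mem_level_iff)
  then have "a \<in> hypertree_verts (Suc 0)" by (simp add: mem_hypertree_verts_iff)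
  with 2 obtain b where b: "b \<in> S" "hypertree_adj a b" by blast
  have "b = a div 2 \<or> a = b div 2 \<or> (2 \<le> b \<and> b < 4 \<and> (b = a + 1 \<or> a = b + 1))"
    using b(2) a1 hypertree_adj_level_Suc_iff[of a 0 b] by (auto simp: mem_level_iff)
  with a23 have "b \<noteq> a" "1 \<le> b" "b < 8" by linarith+
  with a b a23 have "{a, b} \<subseteq> S \<inter> {1..<2 ^ (Suc 0 + 2)}" by auto
  then have "card {a, b} \<le> card (S \<inter> {1..<2 ^ (Suc 0 + 2)})" by (intro card_mono) auto
  with \<open>b \<noteq> a\<close> show ?case by simp
next
  case 3
  have "level (Suc 1) \<subseteq> hypertree_verts (Suc (Suc 0))"
    by (intro level_subset_hypertree_verts) simp
  with 3 have "2 ^ 1 \<le> card (S \<inter> {2 ^ 1..<2 ^ (1 + 3)})"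
    by (intro card_inter_three_levels_ge) blast
  also have "\<dots> \<le> card (S \<inter> {1..<2 ^ (Suc (Suc 0) + 2)})"
    by (intro card_mono) auto
  finally show ?case by simp
next
  case (4 n)
  let ?N = "Suc (Suc (Suc n))"
  have "level (Suc (n + 2)) \<subseteq> hypertree_verts ?N"
    by (intro level_subset_hypertree_verts) simp
  with 4(2) have hi: "2 ^ (n + 2) \<le> card (S \<inter> {2 ^ (n + 2)..<2 ^ (n + 2 + 3)})"
    by (intro card_inter_three_levels_ge) blast
  have "hypertree_verts n \<subseteq> hypertree_verts ?N"
    by (auto simp: mem_hypertree_verts_iff)
  with 4 have lo: "gamma_HT n \<le> card (S \<inter> {1..<2 ^ (n + 2)})" by blast
  have le: "(1::nat) \<le> 2 ^ (n + 2)" "(2::nat) ^ (n + 2) \<le> 2 ^ (n + 2 + 3)"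
    by (simp, intro power_increasing) auto
  have "S \<inter> {1..<2 ^ (?N + 2)} = (S \<inter> {1..<2 ^ (n + 2)}) \<union> (S \<inter> {2 ^ (n + 2)..<2 ^ (n + 2 + 3)})"
    using ivl_disj_un_two(3)[OF le] by (simp add: Int_Un_distrib[symmetric] numeral_3_eq_3)
  moreover have "card \<dots> = card (S \<inter> {1..<2 ^ (n + 2)}) + card (S \<inter> {2 ^ (n + 2)..<2 ^ (n + 2 + 3)})"
    by (intro card_Un_disjoint) auto
  ultimately show ?case using hi lo by simp
qed

section \<open>Upper bound from whole levels\<close>

fun min_total_dom :: "nat \<Rightarrow> nat set" where
  "min_total_dom 0 = {2}"
| "min_total_dom (Suc 0) = {1, 2}"
| "min_total_dom (Suc (Suc 0)) = {2, 3}"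
| "min_total_dom (Suc (Suc (Suc n))) = level (n + 2) \<union> min_total_dom n"

text \<open>The union bound suffices here; equality follows later from the lower bound.\<close>

lemma card_min_total_dom_le: "card (min_total_dom n) \<le> gamma_HT n"
proof (induction n rule: gamma_HT.induct)
  case (4 n)
  have "card (min_total_dom (Suc (Suc (Suc n)))) \<le> card (level (n + 2)) + card (min_total_dom n)"
    by (simp add: card_Un_le)
  with 4 show ?case by (simp add: level_def)
qed auto

lemma level_dominates_three_levels:
  assumes "2 ^ i \<le> v" "v < 2 ^ (i + 3)"
  shows "\<exists>u\<in>level (Suc i). hypertree_adj v u"
proof -
  let ?p = "2 ^ i :: nat"
  have v: "?p \<le> v" "v < 8 * ?p" using assms by (auto simp: power_add)
  have lev: "u \<in> level (Suc i) \<longleftrightarrow> 2 * ?p \<le> u \<and> u < 4 * ?p" for u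
    by (simp add: mem_level_iff)
  \<comment> \<open>These are level \<open>i\<close>, level \<open>i + 2\<close> and the two halves
    of level \<open>i + 1\<close>, which the horizontal edges match with each other.\<close>
  consider "v < 2 * ?p" | "4 * ?p \<le> v" | "2 * ?p \<le> v" "v < 3 * ?p" | "3 * ?p \<le> v" "v < 4 * ?p"
    by linarith
  then show ?thesis
  proof cases
    case 1
    then show ?thesis using v by (intro bexI[of _ "2 * v"]) (auto simp: lev hypertree_adj_def)
  next
    case 2
    then have "v div 2 \<in> level (Suc i)" using v unfolding lev by linarith
    then show ?thesis by (auto simp: hypertree_adj_def)
  next
    case 3
    then have "v \<in> level (Suc i)" "v + ?p \<in> level (Suc i)" by (auto simp: lev)
    then show ?thesis using hypertree_adj_level_Suc_iff by blast
  next
    case 4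
    then have "v \<in> level (Suc i)" "v - ?p \<in> level (Suc i)" "v = (v - ?p) + ?p" by (auto simp: lev)
    then show ?thesis using hypertree_adj_level_Suc_iff by blast
  qed
qed

lemma min_total_dom_dominates:
  assumes "v \<in> hypertree_verts n"
  shows "\<exists>u\<in>min_total_dom n. hypertree_adj v u"
  using assms
proof (induction n rule: gamma_HT.induct)
  case 1
  then have "v = 1" by (simp add: mem_hypertree_verts_iff)
  then show ?case by (simp add: hypertree_adj_def)
next
  case 2
  then have "v = 1 \<or> v = 2 \<or> v = 3" by (auto simp: mem_hypertree_verts_iff)
  then show ?case by (auto simp: hypertree_adj_def)
next
  case 3
  have "level (Suc 0) = {2, 3}" by (auto simp: mem_level_iff)
  with 3 show ?case
    using level_dominates_three_levels[of 0 v] by (simp add: mem_hypertree_verts_iff)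
next
  case (4 n)
  show ?case
  proof (cases "v \<in> hypertree_verts n")
    case True
    with 4(1) show ?thesis by auto
  next
    case False
    \<comment> \<open>The remaining vertices fill levels \<open>n + 1\<close> to
      \<open>n + 3\<close>, around the added level \<open>n + 2\<close>.\<close>
    with 4(2) have "2 ^ (n + 1) \<le> v" "v < 2 ^ (n + 1 + 3)"
      by (auto simp: mem_hypertree_verts_iff power_add)
    from level_dominates_three_levels[OF this] show ?thesis by auto
  qed
qed

text \<open>The \<open>max\<close> covers \<open>n = 0\<close>, where the chosen vertex 2 lies in
  level 1, outside \<open>HT 0\<close>.\<close>

lemma min_total_dom_subset:
  "min_total_dom n \<subseteq> hypertree_verts (max 1 n)"
proof (induction n rule: gamma_HT.induct)
  case (4 n)
  have "level (n + 2) \<subseteq> hypertree_verts (Suc (Suc (Suc n)))"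
    by (intro level_subset_hypertree_verts) simp
  moreover have "(2::nat) ^ (max 1 n + 1) \<le> 2 ^ (Suc (Suc (Suc n)) + 1)"
    by (intro power_increasing) auto
  then have "hypertree_verts (max 1 n) \<subseteq> hypertree_verts (Suc (Suc (Suc n)))"
    unfolding mem_hypertree_verts_iff subset_iff by linarith
  ultimately show ?case using 4 by auto
qed (auto simp: mem_hypertree_verts_iff)

lemma total_domination_number_HT:
  assumes "n \<ge> 1"
  shows "total_domination_number (HT n) = gamma_HT n"
proof -
  have verts: "verts (HT n) = hypertree_verts n" by (simp add: verts_def HT_def)
  have fin: "finite (hypertree_verts n)" by (simp add: hypertree_verts_def)
  have tds_iff: "total_dominating_set (HT n) S \<longleftrightarrow>
      S \<subseteq> hypertree_verts n \<and> (\<forall>v\<in>hypertree_verts n. \<exists>u\<in>S. hypertree_adj v u)" for S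
    unfolding total_dominating_set_def verts by (meson adjacent_HT_iff subsetD)
  have lower: "gamma_HT n \<le> card S" if "total_dominating_set (HT n) S" for S
  proof -
    have S: "S \<subseteq> hypertree_verts n" "\<forall>v\<in>hypertree_verts n. \<exists>u\<in>S. hypertree_adj v u"
      using that tds_iff by auto
    then have "0 \<notin> S" by (auto simp: mem_hypertree_verts_iff)
    then have "gamma_HT n \<le> card (S \<inter> {1..<2 ^ (n + 2)})" using gamma_HT_le_card S(2) by blast
    also have "\<dots> \<le> card S" using finite_subset[OF S(1) fin] by (intro card_mono) auto
    finally show ?thesis .
  qed
  have tds: "total_dominating_set (HT n) (min_total_dom n)"
    using min_total_dom_subset[of n] min_total_dom_dominates assms by (auto simp: tds_iff)
  then have "card (min_total_dom n) = gamma_HT n"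
    using lower card_min_total_dom_le by (meson le_antisym)
  moreover have "{card S | S. total_dominating_set (HT n) S} \<subseteq> card ` Pow (hypertree_verts n)"
    using tds_iff by auto
  then have "finite {card S | S. total_dominating_set (HT n) S}"
    using fin by (meson finite_Pow_iff finite_imageI finite_subset)
  ultimately show ?thesis
    unfolding total_domination_number_def using tds lower
    by (intro Min_eqI) (auto intro!: exI[of _ "min_total_dom n"])
qed

theorem theorem2:
  fixes n :: nat
  assumes "n \<ge> 1"
  shows "real (total_domination_number (HT n)) =
    (if n mod 3 = 0 then 1 / 7 * (2 ^ (n + 2) + 3)
     else if n mod 3 = 1 then 1 / 7 * (2 ^ (n + 2) - 1) + 1
     else 2 / 7 * (2 ^ (n + 1) - 1))"
  using total_domination_number_HT[OF assms] gamma_HT_closed_form by simp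

end
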